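(* Let $k\ge 3$ be an integer and $\alpha=\frac{1}{24k(k+1)}$. Let $G$ be a graph on $n$ vertices, where $n\ge \frac{18k}{\alpha^2}$, that is minimally $k$-connected or minimally $k$-edge-connected. Let $X=(x_v)_{v\in V(G)}$ be a non-negative eigenvector of the adjacency matrix of $G$ with respect to the spectral radius $\rho(G)$, and let $u^*\in V(G)$ satisfy $x_{u^*}=\max_{v\in V(G)}x_v$. If $\rho^2(G)\ge k(n-k)$, then $G$ contains a set $L\subseteq V(G)$ of exactly $k$ vertices such that $x_v\ge \left(1-\frac{1}{2k}\right)x_{u^*}$ and $d_G(v)\ge \left(1-\frac{2}{3k}\right)n$ for each vertex $v\in L$.
   Context: All graphs are finite and simple. $d_G(v)$ is the degree of $v$ in $G$. The spectral radius $\rho(G)$ is the largest eigenvalue of the adjacency matrix $A(G)$. The connectivity (resp. edge-connectivity) of a graph is the minimum number of vertices (resp. edges) whose removal results in a disconnected graph or in the trivial (one-vertex) graph. A graph is $k$-connected (resp. $k$-edge-connected) if its connectivity (resp. edge-connectivity) is at least $k$. A graph is minimally $k$-connected (resp. minimally $k$-edge-connected) if it is $k$-connected (resp. $k$-edge-connected) but deleting any one edge always leaves a graph that is not $k$-connected (resp. not $k$-edge-connected). *)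

theory Defs
  imports "HOL-Analysis.Analysis"
begin

definition simple_graph :: "'v set \<Rightarrow> 'v set set \<Rightarrow> bool" where
  "simple_graph V E \<longleftrightarrow> finite V \<and> (\<forall>e\<in>E. e \<subseteq> V \<and> card e = 2)"

definition vdegree :: "'v set set \<Rightarrow> 'v \<Rightarrow> nat" where
  "vdegree E v = card {e \<in> E. v \<in> e}"


subsection \<open>Connectivity\<close>

text \<open>Only adjacencies inside \<open>W\<close> are followed, so that \<open>graph_connected (V - S) E\<close> is
  connectedness of the graph obtained from \<open>(V, E)\<close> by removing the vertices in \<open>S\<close>.
  The null graph does not count as connected; this affects the connectivities below only when
  \<open>V\<close> itself is empty.\<close>

definition graph_connected :: "'v set \<Rightarrow> 'v set set \<Rightarrow> bool" where
  "graph_connected W E \<longleftrightarrow>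
     W \<noteq> {} \<and> (\<forall>u\<in>W. \<forall>v\<in>W. (u, v) \<in> {(a, b). a \<in> W \<and> b \<in> W \<and> {a, b} \<in> E}\<^sup>*)"

definition vertex_connectivity :: "'v set \<Rightarrow> 'v set set \<Rightarrow> nat" where
  "vertex_connectivity V E =
     (LEAST m. \<exists>S. S \<subseteq> V \<and> card S = m \<and> (\<not> graph_connected (V - S) E \<or> card (V - S) = 1))"

definition edge_connectivity :: "'v set \<Rightarrow> 'v set set \<Rightarrow> nat" where
  "edge_connectivity V E =
     (LEAST m. \<exists>F. F \<subseteq> E \<and> card F = m \<and> (\<not> graph_connected V (E - F) \<or> card V = 1))"

definition k_connected :: "nat \<Rightarrow> 'v set \<Rightarrow> 'v set set \<Rightarrow> bool" where
  "k_connected k V E \<longleftrightarrow> k \<le> vertex_connectivity V E"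

definition k_edge_connected :: "nat \<Rightarrow> 'v set \<Rightarrow> 'v set set \<Rightarrow> bool" where
  "k_edge_connected k V E \<longleftrightarrow> k \<le> edge_connectivity V E"

definition minimally_k_connected :: "nat \<Rightarrow> 'v set \<Rightarrow> 'v set set \<Rightarrow> bool" where
  "minimally_k_connected k V E \<longleftrightarrow>
     k_connected k V E \<and> (\<forall>e\<in>E. \<not> k_connected k V (E - {e}))"

definition minimally_k_edge_connected :: "nat \<Rightarrow> 'v set \<Rightarrow> 'v set set \<Rightarrow> bool" where
  "minimally_k_edge_connected k V E \<longleftrightarrow>
     k_edge_connected k V E \<and> (\<forall>e\<in>E. \<not> k_edge_connected k V (E - {e}))"


subsection \<open>Spectrum\<close>

text \<open>The matrix is indexed by the vertex type, so the graph in question is \<open>(UNIV, E)\<close>.\<close>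

definition adjacency_matrix :: "('v::finite) set set \<Rightarrow> real ^ 'v ^ 'v" where
  "adjacency_matrix E = (\<chi> u v. if {u, v} \<in> E then 1 else 0)"

definition eigenvector :: "real ^ 'n ^ 'n \<Rightarrow> real ^ 'n \<Rightarrow> real \<Rightarrow> bool" where
  "eigenvector A x l \<longleftrightarrow> x \<noteq> 0 \<and> A *v x = l *\<^sub>R x"

definition eigenvalue :: "real ^ 'n ^ 'n \<Rightarrow> real \<Rightarrow> bool" where
  "eigenvalue A l \<longleftrightarrow> (\<exists>x. eigenvector A x l)"

text \<open>The adjacency matrix is real symmetric, hence its eigenvalues are real, and there are
  finitely many and at least one of them.\<close>

definition graph_spectral_radius :: "('v::finite) set set \<Rightarrow> real" where
  "graph_spectral_radius E = Max {l. eigenvalue (adjacency_matrix E) l}"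

end

theory Submission
  imports Defs
begin

text \<open>Every set \<open>S\<close> of vertices of a minimally \<open>k\<close>-connected or minimally \<open>k\<close>-edge-connected
  graph spans at most \<open>k |S|\<close> edges: in the edge case because every edge lies in a cut of at most
  \<open>k\<close> edges, and in the vertex case because, by the argument behind Mader's theorem that the
  vertices of degree greater than \<open>k\<close> induce a forest, the graph is \<open>k\<close>-degenerate.

  Normalise the eigenvector to have maximum 1. Then \<open>\<rho>\<^sup>2 x\<^sub>v = \<Sum>w. c\<^sub>w x\<^sub>w\<close>, where
  \<open>c\<^sub>w\<close> is the number of common neighbours of \<open>v\<close> and \<open>w\<close>, and sparsity gives
  \<open>\<Sum>w\<in>T. (c\<^sub>w - k) \<le> k d(v)\<close> for every \<open>T\<close>. Hence
  \<open>\<rho>\<^sup>2 x\<^sub>v \<le> k d(v) + k \<Sum>w. x\<^sub>w\<close>, and the last sum is of order \<open>sqrt (k n)\<close>, so that large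
  entries force large degrees. If fewer than \<open>k\<close> entries were at least \<open>1 - 1/(2k)\<close>, the same
  estimate at the maximal entry would save a term \<open>n/(2k)\<close> and contradict \<open>\<rho>\<^sup>2 \<ge> k (n - k)\<close>.\<close>

subsection \<open>Sparsity of minimally \<open>k\<close>-connected and \<open>k\<close>-edge-connected graphs\<close>

definition neighbors :: "'v set set \<Rightarrow> 'v \<Rightarrow> 'v set" where
  "neighbors E v = {u. {u, v} \<in> E}"

text \<open>Both kinds of minimality enter the eigenvector estimates only through this
  condition.\<close>

definition sparse_graph :: "nat \<Rightarrow> 'v set \<Rightarrow> 'v set set \<Rightarrow> bool" where
  "sparse_graph k V E \<longleftrightarrow> (\<forall>S\<subseteq>V. card {e \<in> E. e \<subseteq> S} \<le> k * card S)"

lemma neighbors_sym: "u \<in> neighbors E v \<longleftrightarrow> v \<in> neighbors E u"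
  by (simp add: neighbors_def insert_commute)

lemma neighbors_subset: "simple_graph V E \<Longrightarrow> neighbors E v \<subseteq> V"
  by (auto simp: neighbors_def simple_graph_def)

lemma edge_distinct: "simple_graph V E \<Longrightarrow> {u, v} \<in> E \<Longrightarrow> u \<noteq> v"
  by (auto simp: simple_graph_def)

lemma finite_edges: "simple_graph V E \<Longrightarrow> finite E"
  by (rule finite_subset[of _ "Pow V"]) (auto simp: simple_graph_def)

lemma edges_through_vertex:
  assumes "simple_graph V E" "v \<in> S"
  shows "card {e \<in> E. e \<subseteq> S \<and> v \<in> e} = card (neighbors E v \<inter> S)"
proof -
  have "bij_betw (\<lambda>u. {u, v}) (neighbors E v \<inter> S) {e \<in> E. e \<subseteq> S \<and> v \<in> e}"
  proof (rule bij_betw_imageI)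
    show "inj_on (\<lambda>u. {u, v}) (neighbors E v \<inter> S)"
      by (auto simp: inj_on_def doubleton_eq_iff)
    show "(\<lambda>u. {u, v}) ` (neighbors E v \<inter> S) = {e \<in> E. e \<subseteq> S \<and> v \<in> e}"
    proof (intro equalityI subsetI)
      fix e assume e: "e \<in> {e \<in> E. e \<subseteq> S \<and> v \<in> e}"
      then have "card e = 2" using assms by (auto simp: simple_graph_def)
      then obtain p q where "e = {p, q}" by (auto simp: card_2_iff)
      then obtain u where "e = {u, v}" using e by auto
      then show "e \<in> (\<lambda>u. {u, v}) ` (neighbors E v \<inter> S)"
        using e by (auto simp: neighbors_def)
    qed (use assms in \<open>auto simp: neighbors_def\<close>)
  qed
  then show ?thesis by (simp add: bij_betw_same_card)
qed

lemma vdegree_eq_card_neighbors: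
  assumes "simple_graph V E"
  shows "vdegree E v = card (neighbors E v)"
  using edges_through_vertex[OF assms, of v UNIV] by (simp add: vdegree_def)

section \<open>Separations obtained from failing connectivity\<close>

text \<open>\<open>X\<close> collects the vertices still reachable from \<open>a\<close> inside
  \<open>W\<close> once the edge is gone. An edge whose loss destroys connectedness thus becomes the
  only one crossing a partition; this serves the edge case and, with \<open>W = V - S\<close>, the
  vertex case.\<close>

lemma bridge_separation:
  assumes conn: "graph_connected W E" and nconn: "\<not> graph_connected W (E - {{a, b}})"
  obtains X where "X \<subseteq> W" "a \<in> X" "b \<in> W - X"
    "\<And>u w. u \<in> X \<Longrightarrow> w \<in> W - X \<Longrightarrow> {u, w} \<in> E \<Longrightarrow> u = a \<and> w = b"
proof -
  define R where "R = {(p, q). p \<in> W \<and> q \<in> W \<and> {p, q} \<in> E}"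
  define R' where "R' = {(p, q). p \<in> W \<and> q \<in> W \<and> {p, q} \<in> E - {{a, b}}}"
  have symR: "sym (R'\<^sup>*)"
    by (rule sym_rtrancl) (auto simp: R'_def sym_def insert_commute)
  have step: "(p, q) \<in> R' \<or> ({p, q} = {a, b} \<and> a \<in> W \<and> b \<in> W)" if "(p, q) \<in> R" for p q
    using that by (auto simp: R_def R'_def doubleton_eq_iff)
  \<comment> \<open>If this failed, every edge inside \<open>W\<close> could be replaced by an
    \<open>R'\<close>-path, so the deletion would leave \<open>W\<close> connected.\<close>
  have key: "a \<in> W \<and> b \<in> W \<and> (a, b) \<notin> R'\<^sup>*"
  proof (rule ccontr)
    assume neg: "\<not> ?thesis"
    have "R \<subseteq> R'\<^sup>*"
    proof clarify
      fix p q assume "(p, q) \<in> R"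
      with step neg symR show "(p, q) \<in> R'\<^sup>*"
        by (metis doubleton_eq_iff r_into_rtrancl symD)
    qed
    then have "R\<^sup>* \<subseteq> R'\<^sup>*" by (rule rtrancl_subset_rtrancl)
    then have "graph_connected W (E - {{a, b}})"
      using conn unfolding graph_connected_def R_def[symmetric] R'_def[symmetric] by blast
    with nconn show False by simp
  qed
  define X where "X = {v \<in> W. (a, v) \<in> R'\<^sup>*}"
  show thesis
  proof (rule that[of X])
    fix u w assume uw: "u \<in> X" "w \<in> W - X" "{u, w} \<in> E"
    have "(u, w) \<notin> R'" using uw by (auto simp: X_def intro: rtrancl_into_rtrancl)
    then have "{u, w} = {a, b}" using uw by (auto simp: X_def R'_def)
    then show "u = a \<and> w = b" using uw key by (auto simp: doubleton_eq_iff X_def)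
  qed (use key in \<open>auto simp: X_def\<close>)
qed

lemma k_edge_connectedD:
  assumes "k_edge_connected k V E" "F \<subseteq> E" "card F < k"
  shows "graph_connected V (E - F)"
proof (rule ccontr)
  assume "\<not> ?thesis"
  then have "edge_connectivity V E \<le> card F"
    unfolding edge_connectivity_def using assms(2) by (intro Least_le) blast
  with assms show False by (simp add: k_edge_connected_def)
qed

lemma k_connectedD:
  assumes "k_connected k V E" "S \<subseteq> V" "card S < k"
  shows "graph_connected (V - S) E \<and> card (V - S) \<noteq> 1"
proof (rule ccontr)
  assume "\<not> ?thesis"
  then have "vertex_connectivity V E \<le> card S"
    unfolding vertex_connectivity_def using assms(2) by (intro Least_le) blast
  with assms show False by (simp add: k_connected_def)
qed

lemma not_k_edge_connectedE:
  assumes "\<not> k_edge_connected k V E" "card V \<noteq> 1"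
  obtains F where "F \<subseteq> E" "card F < k" "\<not> graph_connected V (E - F)"
proof -
  \<comment> \<open>Deleting all edges is therefore a candidate in the definition of
    \<open>edge_connectivity\<close>, so the \<open>LEAST\<close> is attained.\<close>
  have "\<not> graph_connected V {}"
  proof
    assume "graph_connected V {}"
    then have "V \<noteq> {}" "\<forall>u\<in>V. \<forall>v\<in>V. u = v" by (auto simp: graph_connected_def)
    then have "card V = 1" by (metis is_singletonI' is_singleton_altdef)
    with assms show False by simp
  qed
  then have "\<exists>m F. F \<subseteq> E \<and> card F = m \<and> (\<not> graph_connected V (E - F) \<or> card V = 1)"
    by (metis Diff_cancel order_refl)
  from LeastI_ex[OF this] show thesis
    using assms that unfolding k_edge_connected_def edge_connectivity_def by (metis not_le)
qed

lemma not_k_connectedE: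
  assumes "\<not> k_connected k V E"
  obtains S where "S \<subseteq> V" "card S < k" "\<not> graph_connected (V - S) E \<or> card (V - S) = 1"
proof -
  have "\<exists>m S. S \<subseteq> V \<and> card S = m \<and> (\<not> graph_connected (V - S) E \<or> card (V - S) = 1)"
    \<comment> \<open>Removing all of \<open>V\<close> leaves the null graph, which does not count
      as connected; hence the \<open>LEAST\<close> is attained.\<close>
    by (rule exI[of _ "card V"], rule exI[of _ V]) (simp add: graph_connected_def)
  from LeastI_ex[OF this] show thesis
    using assms that unfolding k_connected_def vertex_connectivity_def by (metis not_le)
qed

section \<open>The edge case: small cuts through every edge\<close>

text \<open>A set \<open>F\<close> of fewer than \<open>k\<close> edges disconnects the graph
  without \<open>ab\<close>, but \<open>E - F\<close> itself is connected. So \<open>ab\<close> is a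
  bridge of \<open>E - F\<close>, and the cut it defines uses only \<open>ab\<close> and edges of
  \<open>F\<close>.\<close>

lemma minimally_k_edge_connected_cut:
  assumes min: "minimally_k_edge_connected k V E" and G: "simple_graph V E" and e: "{a, b} \<in> E"
  obtains X where "a \<in> X" "b \<notin> X"
    "card {e \<in> E. e \<inter> X \<noteq> {} \<and> e - X \<noteq> {}} \<le> k"
proof -
  have "card V \<noteq> 1"
    using G e edge_distinct[OF G e] by (auto simp: simple_graph_def card_1_singleton_iff)
  then obtain F where F: "F \<subseteq> E - {{a, b}}" "card F < k" "\<not> graph_connected V (E - {{a, b}} - F)"
    using min e not_k_edge_connectedE unfolding minimally_k_edge_connected_def by metis
  have conn: "graph_connected V (E - F)"
    using F min by (intro k_edge_connectedD) (auto simp: minimally_k_edge_connected_def)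
  have nconn: "\<not> graph_connected V (E - F - {{a, b}})"
    using F by (metis Diff_insert Diff_insert2)
  obtain X where X: "X \<subseteq> V" "a \<in> X" "b \<in> V - X"
    "\<And>u w. u \<in> X \<Longrightarrow> w \<in> V - X \<Longrightarrow> {u, w} \<in> E - F \<Longrightarrow> u = a \<and> w = b"
    using bridge_separation[OF conn nconn] by blast
  have "finite F" using F finite_edges[OF G] finite_subset by blast
  have "{e \<in> E. e \<inter> X \<noteq> {} \<and> e - X \<noteq> {}} \<subseteq> insert {a, b} F"
  proof
    fix e assume "e \<in> {e \<in> E. e \<inter> X \<noteq> {} \<and> e - X \<noteq> {}}"
    then obtain u w where e: "e \<in> E" "u \<in> e" "u \<in> X" "w \<in> e" "w \<notin> X" by blast
    have "card e = 2" "w \<in> V" using e G by (auto simp: simple_graph_def)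
    then have "e = {u, w}" using e by (auto simp: card_2_iff)
    then show "e \<in> insert {a, b} F" using X(4)[of u w] e \<open>w \<in> V\<close> by auto
  qed
  then have "card {e \<in> E. e \<inter> X \<noteq> {} \<and> e - X \<noteq> {}} \<le> card (insert {a, b} F)"
    using \<open>finite F\<close> by (intro card_mono) auto
  also have "\<dots> \<le> k" using F(2) \<open>finite F\<close> card_insert_le_m1[of k F] by (simp add: card_insert_if)
  finally have "card {e \<in> E. e \<inter> X \<noteq> {} \<and> e - X \<noteq> {}} \<le> k" .
  then show thesis using X(2,3) by (intro that[of X]) auto
qed

lemma minimally_k_edge_connected_sparse:
  assumes min: "minimally_k_edge_connected k V E" and G: "simple_graph V E"
  shows "sparse_graph k V E"
proof -
  \<comment> \<open>The induction needs the stronger bound \<open>k * card S - k\<close> for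
    nonempty \<open>S\<close>: splitting \<open>S\<close> along a cut gains \<open>k\<close> twice,
    once to pay for the cut edges and once to restore the bound.\<close>
  have "S \<noteq> {} \<Longrightarrow> card {e \<in> E. e \<subseteq> S} + k \<le> k * card S" if "S \<subseteq> V" for S
    using that
  proof (induction "card S" arbitrary: S rule: less_induct)
    case less
    have finS: "finite S" using G less.prems finite_subset by (auto simp: simple_graph_def)
    show ?case
    proof (cases "{e \<in> E. e \<subseteq> S} = {}")
      case True
      have "1 \<le> card S" using finS less.prems by (simp add: Suc_le_eq card_gt_0_iff)
      then show ?thesis unfolding True by simp
    next
      case False
      then obtain e where e: "e \<in> E" "e \<subseteq> S" by blast
      then have "card e = 2" using G by (simp add: simple_graph_def)
      then obtain a b where ab: "{a, b} \<in> E" "{a, b} \<subseteq> S"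
        using e by (auto simp: card_2_iff)
      obtain X where X: "a \<in> X" "b \<notin> X" "card {e \<in> E. e \<inter> X \<noteq> {} \<and> e - X \<noteq> {}} \<le> k"
        using minimally_k_edge_connected_cut[OF min G ab(1)] .
      let ?P = "{e \<in> E. e \<subseteq> S \<inter> X}" and ?Q = "{e \<in> E. e \<subseteq> S - X}"
        and ?C = "{e \<in> E. e \<inter> X \<noteq> {} \<and> e - X \<noteq> {}}"
      have "card (S \<inter> X) < card S" "card (S - X) < card S"
        using ab X by (intro psubset_card_mono[OF finS]; blast)+
      then have IH: "card ?P + k \<le> k * card (S \<inter> X)" "card ?Q + k \<le> k * card (S - X)"
        using less.hyps[of "S \<inter> X"] less.hyps[of "S - X"] less.prems ab X by blast+
      have "card {e \<in> E. e \<subseteq> S} \<le> card (?P \<union> ?Q \<union> ?C)"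
      proof (rule card_mono)
        show "finite (?P \<union> ?Q \<union> ?C)" using finite_edges[OF G] by simp
      qed blast
      also have "\<dots> \<le> card (?P \<union> ?Q) + card ?C" by (rule card_Un_le)
      also have "card (?P \<union> ?Q) \<le> card ?P + card ?Q" by (rule card_Un_le)
      finally have "card {e \<in> E. e \<subseteq> S} + k \<le> k * card (S \<inter> X) + k * card (S - X)"
        using IH X(3) by linarith
      also have "\<dots> = k * (card (S \<inter> X) + card (S - X))" by (simp add: distrib_left)
      also have "card (S \<inter> X) + card (S - X) = card S"
        using finS by (metis card_Int_Diff)
      finally show ?thesis .
    qed
  qed
  moreover have "{e \<in> E. e \<subseteq> {}} = {}" using G by (auto simp: simple_graph_def)
  ultimately show ?thesis unfolding sparse_graph_def
    by (metis add_leD1 card.empty zero_le)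
qed

section \<open>The vertex case: crossing separations and degeneracy\<close>

text \<open>A mixed separator, made of fewer than \<open>k\<close> vertices and one edge. The edge
  is oriented, with \<open>a\<close> in \<open>X\<close>, so that the sides at a given vertex can be
  compared in size.\<close>

definition critical_separation ::
    "nat \<Rightarrow> 'v set \<Rightarrow> 'v set set \<Rightarrow> 'v \<Rightarrow> 'v \<Rightarrow> 'v set \<Rightarrow> 'v set \<Rightarrow> 'v set \<Rightarrow> bool" where
  "critical_separation k V E a b S X Y \<longleftrightarrow>
     X \<union> Y \<union> S = V \<and> X \<inter> Y = {} \<and> X \<inter> S = {} \<and> Y \<inter> S = {} \<and> card S < k \<and>
     a \<in> X \<and> b \<in> Y \<and> (\<forall>u\<in>X. \<forall>w\<in>Y. {u, w} \<in> E \<longrightarrow> u = a \<and> w = b)"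

lemma critical_separation_sym:
  "critical_separation k V E a b S X Y \<Longrightarrow> critical_separation k V E b a S Y X"
  unfolding critical_separation_def by (auto simp: insert_commute)

text \<open>Without the edge, removing some \<open>S\<close> of fewer than \<open>k\<close> vertices
  disconnects the graph; with the edge, \<open>V - S\<close> is still connected. The edge is thus a
  bridge there.\<close>

lemma minimally_k_connected_separation:
  assumes min: "minimally_k_connected k V E" and e: "{a, b} \<in> E"
  obtains S X Y where "critical_separation k V E a b S X Y"
proof -
  have "\<not> k_connected k V (E - {{a, b}})" and kc: "k_connected k V E"
    using min e by (auto simp: minimally_k_connected_def)
  \<comment> \<open>The alternative \<open>card (V - S) = 1\<close> does not depend on the edges and
    is already excluded by \<open>kc\<close>.\<close>
  then obtain S where S: "S \<subseteq> V" "card S < k" "\<not> graph_connected (V - S) (E - {{a, b}})"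
    using not_k_connectedE k_connectedD by metis
  obtain X where "X \<subseteq> V - S" "a \<in> X" "b \<in> V - S - X"
    "\<And>u w. u \<in> X \<Longrightarrow> w \<in> V - S - X \<Longrightarrow> {u, w} \<in> E \<Longrightarrow> u = a \<and> w = b"
    using bridge_separation[OF k_connectedD[OF kc S(1,2), THEN conjunct1] S(3)] by blast
  then have "critical_separation k V E a b S X (V - S - X)"
    using S unfolding critical_separation_def by blast
  then show thesis by (rule that)
qed

text \<open>A walk from \<open>z\<close> that avoids \<open>W\<close> never leaves \<open>Z\<close>,
  so \<open>W\<close> separates \<open>z\<close> from \<open>r\<close>.\<close>

lemma k_connected_boundary:
  assumes kc: "k_connected k V E" and "W \<subseteq> V" "Z \<subseteq> V - W" "z \<in> Z" "r \<in> V - W - Z"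
    and nb: "\<And>u w. u \<in> Z \<Longrightarrow> w \<in> V \<Longrightarrow> {u, w} \<in> E \<Longrightarrow> w \<in> Z \<union> W"
  shows "k \<le> card W"
proof (rule ccontr)
  assume "\<not> k \<le> card W"
  then have "graph_connected (V - W) E"
    using k_connectedD[OF kc \<open>W \<subseteq> V\<close>] by simp
  then have "(z, r) \<in> {(a, b). a \<in> V - W \<and> b \<in> V - W \<and> {a, b} \<in> E}\<^sup>*"
    using assms(3-5) unfolding graph_connected_def by blast
  then have "r \<in> Z"
    by (induction rule: rtrancl_induct) (use assms(4) nb in auto)
  with assms(5) show False by simp
qed

lemma card_three_parts:
  assumes "finite A" "A = B \<union> C \<union> D" "B \<inter> C = {}" "B \<inter> D = {}" "C \<inter> D = {}"
  shows "card A = card B + card C + card D"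
proof -
  have "card A = card (B \<union> C) + card D"
    using assms by (simp add: card_Un_disjoint Int_Un_distrib2)
  then show ?thesis using assms by (simp add: card_Un_disjoint)
qed

text \<open>The corner \<open>Y \<inter> Q\<close> of two crossing separations at \<open>x\<close> is empty, since otherwise its boundary
  would be too large for the opposite corner \<open>X \<inter> P\<close>; then \<open>|X| \<le> |Q|\<close> again makes the boundary of
  \<open>X \<inter> P\<close> too small.\<close>

lemma crossing_separations_degree:
  assumes kc: "k_connected k V E" and G: "simple_graph V E"
    and sep1: "critical_separation k V E x y S X Y"
    and sep2: "critical_separation k V E x z T P Q"
    and xy: "{x, y} \<in> E" and xz: "{x, z} \<in> E" and "y \<noteq> z"
    and le: "card X \<le> card Q"
  shows "card (neighbors E x) \<le> k"
proof -
  have s1: "X \<union> Y \<union> S = V" "X \<inter> Y = {}" "X \<inter> S = {}" "Y \<inter> S = {}" "x \<in> X" "y \<in> Y"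
    and cS: "card S < k" and e1: "\<And>u w. u \<in> X \<Longrightarrow> w \<in> Y \<Longrightarrow> {u, w} \<in> E \<Longrightarrow> u = x \<and> w = y"
    using sep1 unfolding critical_separation_def by blast+
  have s2: "P \<union> Q \<union> T = V" "P \<inter> Q = {}" "P \<inter> T = {}" "Q \<inter> T = {}" "x \<in> P" "z \<in> Q"
    and cT: "card T < k" and e2: "\<And>u w. u \<in> P \<Longrightarrow> w \<in> Q \<Longrightarrow> {u, w} \<in> E \<Longrightarrow> u = x \<and> w = z"
    using sep2 unfolding critical_separation_def by blast+
  have sub: "X \<subseteq> V" "Y \<subseteq> V" "S \<subseteq> V" "P \<subseteq> V" "Q \<subseteq> V" "T \<subseteq> V"
    using s1(1) s2(1) by blast+
  have cover: "v \<in> V \<Longrightarrow> v \<in> X \<or> v \<in> Y \<or> v \<in> S" "v \<in> V \<Longrightarrow> v \<in> P \<or> v \<in> Q \<or> v \<in> T" for v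
    using s1(1) s2(1) by blast+
  have parts: "S \<subseteq> P \<union> Q \<union> T" "X \<subseteq> P \<union> Q \<union> T" "T \<subseteq> X \<union> Y \<union> S" "Q \<subseteq> X \<union> Y \<union> S"
    using sub cover by blast+
  note dis = s1(2-) s2(2-)
  have finV: "finite V" using G by (simp add: simple_graph_def)
  have fin: "finite S" "finite X" "finite T"
    using s1(1) s2(1) finV by (metis finite_Un)+
  \<comment> \<open>\<open>W\<close> and \<open>W'\<close> are the boundaries of the opposite
    corners \<open>X \<inter> P\<close> and \<open>Y \<inter> Q\<close>; their sizes add up to
    \<open>card S + card T\<close>, at most \<open>2 * k - 2\<close>.\<close>
  define W where "W = (S \<inter> P) \<union> (S \<inter> T) \<union> (X \<inter> T)"
  define W' where "W' = (S \<inter> Q) \<union> (S \<inter> T) \<union> (Y \<inter> T)"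
  have finW: "finite W" "finite W'" using fin by (simp_all add: W_def W'_def)
  have cardW: "card W = card (S \<inter> P) + card (S \<inter> T) + card (X \<inter> T)"
    by (rule card_three_parts[OF finW(1) W_def]) (use dis in auto)
  have cardW': "card W' = card (S \<inter> Q) + card (S \<inter> T) + card (Y \<inter> T)"
    by (rule card_three_parts[OF finW(2) W'_def]) (use dis in auto)
  have cardS: "card S = card (S \<inter> P) + card (S \<inter> T) + card (S \<inter> Q)"
    by (rule card_three_parts[OF fin(1)]) (use dis parts(1) in auto)
  have cardT: "card T = card (X \<inter> T) + card (S \<inter> T) + card (Y \<inter> T)"
    by (rule card_three_parts[OF fin(3)]) (use dis parts(3) in auto)
  \<comment> \<open>Only the two critical edges \<open>xy\<close> and \<open>xz\<close> can leave
    the corner past \<open>W\<close>, and both start at \<open>x\<close>.\<close>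
  have nb: "w \<in> (X \<inter> P) \<union> W \<or> u = x \<and> w \<in> {y, z}"
    if "u \<in> X \<inter> P" "w \<in> V" "{u, w} \<in> E" for u w
    using that cover[of w] e1[of u w] e2[of u w] unfolding W_def by auto
  have "y \<notin> Q" using e2[of x y] xy s2(5) \<open>y \<noteq> z\<close> by blast
  have "z \<notin> Y" using e1[of x z] xz s1(5) \<open>y \<noteq> z\<close> by blast
  \<comment> \<open>Moving \<open>x\<close> from the corner into its boundary disposes of both
    exceptional edges.\<close>
  have corner: "k \<le> Suc (card W)" if ne: "X \<inter> P \<noteq> {x}"
  proof -
    obtain u where u: "u \<in> X \<inter> P - {x}" using ne s1(5) s2(5) by auto
    have "k \<le> card (insert x W)"
    proof (rule k_connected_boundary[OF kc, of _ "X \<inter> P - {x}" u y])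
      show "insert x W \<subseteq> V" "X \<inter> P - {x} \<subseteq> V - insert x W" "y \<in> V - insert x W - (X \<inter> P - {x})"
        using dis sub unfolding W_def by auto
    qed (use u nb in auto)
    also have "\<dots> \<le> Suc (card W)" using finW by (simp add: card_insert_if)
    finally show ?thesis .
  qed
  have single: "card (neighbors E x) \<le> card W + 2" if "X \<inter> P = {x}"
  proof -
    have "neighbors E x \<subseteq> W \<union> {y, z}"
    proof
      fix w assume w: "w \<in> neighbors E x"
      then have "{x, w} \<in> E" by (simp add: neighbors_def insert_commute)
      moreover have "w \<in> V" using w neighbors_subset[OF G, of x] by blast
      moreover have "w \<noteq> x" using edge_distinct[OF G \<open>{x, w} \<in> E\<close>] by simp
      ultimately show "w \<in> W \<union> {y, z}" using nb[of x w] that by auto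
    qed
    then have "card (neighbors E x) \<le> card (W \<union> {y, z})" using finW by (intro card_mono) auto
    also have "\<dots> \<le> card W + card {y, z}" by (rule card_Un_le)
    finally show ?thesis using \<open>y \<noteq> z\<close> by simp
  qed
  \<comment> \<open>This contradicts \<open>corner\<close>, so the corner is \<open>{x}\<close>, and
    then \<open>single\<close> bounds the degree by \<open>k\<close>.\<close>
  have "card W + 2 \<le> k"
  proof (cases "Y \<inter> Q = {}")
    case False
    then obtain u where u: "u \<in> Y \<inter> Q" by blast
    have "k \<le> card W'"
    proof (rule k_connected_boundary[OF kc, of _ "Y \<inter> Q" u x])
      show "W' \<subseteq> V" "Y \<inter> Q \<subseteq> V - W'" "x \<in> V - W' - Y \<inter> Q"
        using dis sub unfolding W'_def by auto
      fix u w assume uw: "u \<in> Y \<inter> Q" "w \<in> V" "{u, w} \<in> E"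
      have wu: "{w, u} \<in> E" using uw by (simp add: insert_commute)
      have "w \<notin> X" using e1[of w u] uw wu \<open>y \<notin> Q\<close> by auto
      moreover have "w \<notin> P" using e2[of w u] uw wu \<open>z \<notin> Y\<close> by auto
      ultimately show "w \<in> Y \<inter> Q \<union> W'" using cover[OF uw(2)] unfolding W'_def by auto
    qed (use u in auto)
    then show ?thesis using cardW cardW' cardS cardT cS cT by linarith
  next
    case True
    \<comment> \<open>Here \<open>Q\<close> lies within \<open>X\<close> and \<open>S\<close>, so
      \<open>card X \<le> card Q\<close> yields \<open>card (X \<inter> P) + card (X \<inter> T)
      \<le> card (S \<inter> Q)\<close>. As \<open>x\<close> lies in \<open>X \<inter> P\<close>,
      this makes \<open>card W < card S\<close>.\<close>
    have "card Q \<le> card (X \<inter> Q \<union> S \<inter> Q)"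
    proof (rule card_mono)
      show "finite (X \<inter> Q \<union> S \<inter> Q)" using fin by simp
      show "Q \<subseteq> X \<inter> Q \<union> S \<inter> Q" using parts(4) True by blast
    qed
    moreover have "card (X \<inter> Q \<union> S \<inter> Q) \<le> card (X \<inter> Q) + card (S \<inter> Q)"
      by (rule card_Un_le)
    moreover have "card X = card (X \<inter> P) + card (X \<inter> T) + card (X \<inter> Q)"
      by (rule card_three_parts[OF fin(2)]) (use dis parts(2) in auto)
    moreover have "card (X \<inter> P) \<noteq> 0" using s1(5) s2(5) fin(2) by auto
    ultimately show ?thesis using le cardW cardS cS by linarith
  qed
  then show ?thesis using corner single by (cases "X \<inter> P = {x}") simp_all
qed

text \<open>If all degrees inside \<open>S\<close> exceeded \<open>k\<close>, take an edge
  \<open>xy\<close> inside \<open>S\<close> and a separation for it whose side \<open>X\<close> at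
  \<open>x\<close> is smallest. A second edge \<open>xz\<close> inside \<open>S\<close> yields
  another separation, and crossing the two forces degree at most \<open>k\<close> at
  \<open>x\<close>.\<close>

lemma minimally_k_connected_degenerate:
  assumes min: "minimally_k_connected k V E" and G: "simple_graph V E" and "k \<ge> 1"
    and S: "S \<subseteq> V" "S \<noteq> {}"
  shows "\<exists>v\<in>S. card (neighbors E v \<inter> S) \<le> k"
proof (rule ccontr)
  assume "\<not> ?thesis"
  then have gt: "card (neighbors E v \<inter> S) > k" if "v \<in> S" for v
    using that by force
  have kc: "k_connected k V E" using min by (simp add: minimally_k_connected_def)
  have finN: "finite (neighbors E v)" for v
    using neighbors_subset[OF G] G by (meson finite_subset simple_graph_def)
  have another: "\<exists>z. z \<in> S \<and> z \<noteq> y \<and> {v, z} \<in> E" if "v \<in> S" for v y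
  proof (rule ccontr)
    assume "\<not> ?thesis"
    then have "neighbors E v \<inter> S \<subseteq> {y}" by (auto simp: neighbors_def insert_commute)
    then have "card (neighbors E v \<inter> S) \<le> 1"
      by (metis card.empty card_insert_le_m1 card_mono finite.emptyI finite.insertI is_singletonI
          is_singleton_altdef)
    with gt[OF that] \<open>k \<ge> 1\<close> show False by simp
  qed
  define D where "D = {(x, y, U, X, Y). x \<in> S \<and> y \<in> S \<and> {x, y} \<in> E \<and>
    critical_separation k V E x y U X Y}"
  obtain v where "v \<in> S" using S by blast
  moreover obtain w where "w \<in> S" "{v, w} \<in> E" using another[OF \<open>v \<in> S\<close>] by blast
  moreover obtain U X Y where "critical_separation k V E v w U X Y"
    using minimally_k_connected_separation[OF min \<open>{v, w} \<in> E\<close>] .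
  ultimately have "(v, w, U, X, Y) \<in> D" by (simp add: D_def)
  then have "\<exists>d. d \<in> D" by blast
  then obtain d where d: "d \<in> D" "\<And>d'. d' \<in> D \<Longrightarrow>
      (case d of (x, y, U, X, Y) \<Rightarrow> card X) \<le> (case d' of (x, y, U, X, Y) \<Rightarrow> card X)"
    using ex_has_least_nat[of "\<lambda>d. d \<in> D" _ "\<lambda>d. case d of (x, y, U, X, Y) \<Rightarrow> card X"] by blast
  obtain x y U X Y where xy: "x \<in> S" "y \<in> S" "{x, y} \<in> E" "critical_separation k V E x y U X Y"
    and least: "\<And>d'. d' \<in> D \<Longrightarrow> card X \<le> (case d' of (x, y, U, X, Y) \<Rightarrow> card X)"
  proof -
    obtain x y U X Y where "d = (x, y, U, X, Y)" by (cases d)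
    then show thesis using d that[of x y U X Y] by (simp add: D_def)
  qed
  obtain z where z: "z \<in> S" "z \<noteq> y" "{x, z} \<in> E" using another[OF \<open>x \<in> S\<close>] by blast
  obtain T P Q where sep: "critical_separation k V E x z T P Q"
    using minimally_k_connected_separation[OF min z(3)] .
  \<comment> \<open>\<open>D\<close> contains both orientations of an edge, so the far side
    \<open>Q\<close> competes for the minimum; this supplies the size hypothesis of the crossing
    lemma.\<close>
  have "(z, x, T, Q, P) \<in> D"
    using critical_separation_sym[OF sep] z xy(1) by (auto simp: D_def insert_commute)
  then have "card X \<le> card Q" using least by fastforce
  then have "card (neighbors E x) \<le> k"
    using crossing_separations_degree[OF kc G xy(4) sep xy(3) z(3)] z(2) by simp
  moreover have "card (neighbors E x \<inter> S) \<le> card (neighbors E x)"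
    using finN by (intro card_mono) auto
  ultimately show False using gt[OF xy(1)] by simp
qed

text \<open>Peeling off a vertex with at most \<open>k\<close> neighbours in \<open>S\<close> costs
  at most \<open>k\<close> edges.\<close>

lemma minimally_k_connected_sparse:
  assumes min: "minimally_k_connected k V E" and G: "simple_graph V E" and "k \<ge> 1"
  shows "sparse_graph k V E"
  unfolding sparse_graph_def
proof (intro allI impI)
  fix S assume "S \<subseteq> V"
  then show "card {e \<in> E. e \<subseteq> S} \<le> k * card S"
  proof (induction "card S" arbitrary: S rule: less_induct)
    case less
    have finS: "finite S" using G less.prems finite_subset by (auto simp: simple_graph_def)
    show ?case
    proof (cases "S = {}")
      case True
      then have empty: "{e \<in> E. e \<subseteq> S} = {}" using G by (auto simp: simple_graph_def)
      show ?thesis unfolding empty by simp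
    next
      case False
      then obtain v where v: "v \<in> S" "card (neighbors E v \<inter> S) \<le> k"
        using minimally_k_connected_degenerate[OF min G \<open>k \<ge> 1\<close> less.prems False] by blast
      have cardS: "card S = Suc (card (S - {v}))" using v(1) finS by (metis card.remove)
      have IH: "card {e \<in> E. e \<subseteq> S - {v}} \<le> k * card (S - {v})"
        using less.hyps[of "S - {v}"] less.prems cardS by auto
      have "card {e \<in> E. e \<subseteq> S} \<le> card ({e \<in> E. e \<subseteq> S - {v}} \<union> {e \<in> E. e \<subseteq> S \<and> v \<in> e})"
        using finite_edges[OF G] by (intro card_mono) (simp, blast)
      also have "\<dots> \<le> card {e \<in> E. e \<subseteq> S - {v}} + card {e \<in> E. e \<subseteq> S \<and> v \<in> e}"
        by (rule card_Un_le)
      also have "\<dots> \<le> k * card (S - {v}) + k"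
        using IH edges_through_vertex[OF G v(1)] v(2) by simp
      also have "\<dots> = k * card S" using cardS by simp
      finally show ?thesis .
    qed
  qed
qed

text \<open>An edge gives two ordered pairs only if it lies inside \<open>A \<inter> B\<close>.\<close>

lemma sparse_graph_sum_neighbors:
  assumes sp: "sparse_graph k V E" and G: "simple_graph V E" and AB: "A \<subseteq> V" "B \<subseteq> V"
  shows "(\<Sum>w\<in>B. card (neighbors E w \<inter> A)) \<le> k * (card A + card B)"
proof -
  have fin: "finite A" "finite B" "finite E"
    using AB G finite_edges[OF G] finite_subset by (auto simp: simple_graph_def)
  let ?D = "{p \<in> B \<times> A. {snd p, fst p} \<in> E}" and ?EU = "{e \<in> E. e \<subseteq> A \<union> B}"
    and ?EI = "{e \<in> E. e \<subseteq> A \<inter> B}"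
  let ?fib = "\<lambda>e. {p \<in> ?D. {snd p, fst p} = e}"
  have "(\<Sum>w\<in>B. card (neighbors E w \<inter> A)) = card (SIGMA w:B. neighbors E w \<inter> A)"
    using fin by simp
  also have "(SIGMA w:B. neighbors E w \<inter> A) = ?D" by (auto simp: neighbors_def)
  also have "card ?D = (\<Sum>e\<in>?EU. card (?fib e))"
  proof -
    have "card (\<Union>e\<in>?EU. ?fib e) = (\<Sum>e\<in>?EU. card (?fib e))"
      using fin by (intro card_UN_disjoint) auto
    moreover have "(\<Union>e\<in>?EU. ?fib e) = ?D" by auto
    ultimately show ?thesis by simp
  qed
  also have "\<dots> \<le> (\<Sum>e\<in>?EU. 1 + (if e \<subseteq> A \<inter> B then 1 else 0))"
  proof (rule sum_mono)
    fix e assume "e \<in> ?EU"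
    then have "card e = 2" using G by (simp add: simple_graph_def)
    then obtain p q where pq: "e = {p, q}" "p \<noteq> q" by (auto simp: card_2_iff)
    show "card (?fib e) \<le> 1 + (if e \<subseteq> A \<inter> B then 1 else 0)"
    proof (cases "e \<subseteq> A \<inter> B")
      case True
      have "?fib e \<subseteq> {(p, q), (q, p)}" using pq by (auto simp: doubleton_eq_iff)
      then have "card (?fib e) \<le> card {(p, q), (q, p)}" by (intro card_mono) auto
      then show ?thesis using True pq by simp
    next
      case False
      then have "?fib e \<subseteq> {(p, q)} \<or> ?fib e \<subseteq> {(q, p)}"
        using pq by (auto simp: doubleton_eq_iff)
      then obtain r where "?fib e \<subseteq> {r}" by blast
      then have "card (?fib e) \<le> card {r}" by (intro card_mono) auto
      then show ?thesis by simp
    qed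
  qed
  also have "\<dots> = card ?EU + card {e \<in> ?EU. e \<subseteq> A \<inter> B}"
  proof -
    have "(\<Sum>e\<in>?EU. if e \<subseteq> A \<inter> B then 1 else 0) = (\<Sum>e | e \<in> ?EU \<and> e \<subseteq> A \<inter> B. (1::nat))"
      using fin by (intro sum.inter_filter[symmetric]) simp
    then show ?thesis by (simp only: sum.distrib card_eq_sum)
  qed
  also have "{e \<in> ?EU. e \<subseteq> A \<inter> B} = ?EI" by auto
  \<comment> \<open>Sparsity is applied to the union and to the intersection, whose sizes add up to
    \<open>card A + card B\<close>.\<close>
  also have "card ?EU + card ?EI \<le> k * card (A \<union> B) + k * card (A \<inter> B)"
  proof (rule add_mono)
    have *: "card {e \<in> E. e \<subseteq> S} \<le> k * card S" if "S \<subseteq> V" for S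
      using sp that by (simp add: sparse_graph_def)
    show "card ?EU \<le> k * card (A \<union> B)" "card ?EI \<le> k * card (A \<inter> B)"
      by (rule *; use AB in blast)+
  qed
  also have "\<dots> = k * (card A + card B)"
    using card_Un_Int[OF fin(1,2)] by (simp add: distrib_left)
  finally show ?thesis .
qed

subsection \<open>Eigenvector estimates\<close>

text \<open>Only the indices with \<open>c w > K\<close> contribute positively to \<open>\<Sum>w. (c w - K) * y w\<close>.\<close>

lemma weighted_sum_bound:
  fixes c y :: "'a \<Rightarrow> real" and D K C M \<beta> :: real
  assumes fin: "finite A" and L: "L \<subseteq> A"
    and sums: "\<And>T. T \<subseteq> A \<Longrightarrow> sum c T \<le> D + K * card T"
    and c: "\<And>w. w \<in> A \<Longrightarrow> c w \<le> C" and K: "0 \<le> K" and C: "0 \<le> C"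
    and y: "\<And>w. w \<in> A \<Longrightarrow> 0 \<le> y w" "\<And>w. w \<in> A \<Longrightarrow> y w \<le> M"
      "\<And>w. w \<in> A - L \<Longrightarrow> y w \<le> \<beta>"
    and \<beta>: "0 \<le> \<beta>" "\<beta> \<le> M"
  shows "(\<Sum>w\<in>A. c w * y w) \<le> K * sum y A + \<beta> * D + (M - \<beta>) * (card L * C)"
proof -
  define T where "T = {w \<in> A. c w > K}"
  have T: "finite T" "T \<subseteq> A" using fin by (auto simp: T_def)
  have "(\<Sum>w\<in>A. (c w - K) * y w) \<le> (\<Sum>w\<in>A. if w \<in> T then (c w - K) * y w else 0)"
    by (rule sum_mono) (auto simp: T_def y mult_nonpos_nonneg)
  also have "\<dots> = (\<Sum>w\<in>T. (c w - K) * y w)"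
    using fin T by (simp add: sum.If_cases Int_absorb1)
  \<comment> \<open>Each \<open>y w\<close> is at most \<beta>, except for an excess of at most
    \<open>M - \<beta>\<close> on \<open>L\<close>, where \<open>c w - K\<close> is bounded crudely
    by \<open>C\<close>.\<close>
  also have "\<dots> \<le> (\<Sum>w\<in>T. (c w - K) * \<beta> + (if w \<in> L then (M - \<beta>) * C else 0))"
  proof (rule sum_mono)
    fix w assume w: "w \<in> T"
    then have wA: "w \<in> A" and pos: "0 \<le> c w - K" by (auto simp: T_def)
    show "(c w - K) * y w \<le> (c w - K) * \<beta> + (if w \<in> L then (M - \<beta>) * C else 0)"
    proof (cases "w \<in> L")
      case True
      have "(c w - K) * y w \<le> (c w - K) * M" using pos y wA by (intro mult_left_mono) auto
      also have "\<dots> = (c w - K) * \<beta> + (c w - K) * (M - \<beta>)" by (simp add: algebra_simps)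
      also have "(c w - K) * (M - \<beta>) \<le> C * (M - \<beta>)"
        using c[OF wA] K \<beta> by (intro mult_right_mono) auto
      finally show ?thesis using True by (simp add: mult.commute)
    next
      case False
      then show ?thesis using pos y wA by (auto intro!: mult_left_mono)
    qed
  qed
  also have "\<dots> = \<beta> * (sum c T - K * card T) + card (T \<inter> L) * ((M - \<beta>) * C)"
    using T by (simp add: sum.distrib sum.If_cases sum_subtractf sum_distrib_left algebra_simps)
  also have "\<dots> \<le> \<beta> * D + card L * ((M - \<beta>) * C)"
  proof (rule add_mono)
    show "\<beta> * (sum c T - K * card T) \<le> \<beta> * D"
      using sums[OF T(2)] \<beta> by (intro mult_left_mono) auto
    have "card (T \<inter> L) \<le> card L" using fin L finite_subset by (intro card_mono) auto
    then show "real (card (T \<inter> L)) * ((M - \<beta>) * C) \<le> card L * ((M - \<beta>) * C)"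
      using \<beta> C by (intro mult_right_mono) auto
  qed
  finally show ?thesis
    by (simp add: left_diff_distrib sum_subtractf sum_distrib_left[symmetric] algebra_simps)
qed

lemma eigenvector_sum_neighbors:
  fixes x :: "real ^ ('v::finite)"
  assumes "eigenvector (adjacency_matrix E) x l"
  shows "(\<Sum>w\<in>neighbors E v. x $ w) = l * x $ v"
proof -
  have "l * x $ v = (adjacency_matrix E *v x) $ v"
    using assms by (simp add: eigenvector_def)
  also have "\<dots> = (\<Sum>w\<in>UNIV. if w \<in> neighbors E v then x $ w else 0)"
    by (auto simp: matrix_vector_mult_def adjacency_matrix_def neighbors_def insert_commute
        intro!: sum.cong)
  also have "\<dots> = (\<Sum>w\<in>neighbors E v. x $ w)"
    by (simp add: sum.If_cases)
  finally show ?thesis by simp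
qed

lemma sum_neighbors_swap:
  fixes f :: "'v::finite \<Rightarrow> real"
  shows "(\<Sum>u\<in>A. \<Sum>w\<in>neighbors E u. f w) = (\<Sum>w\<in>UNIV. card (neighbors E w \<inter> A) * f w)"
proof -
  have "(\<Sum>u\<in>A. \<Sum>w\<in>neighbors E u. f w) = (\<Sum>u\<in>A. \<Sum>w | w \<in> UNIV \<and> u \<in> neighbors E w. f w)"
    by (intro sum.cong) (auto simp: neighbors_sym)
  also have "\<dots> = (\<Sum>w\<in>UNIV. \<Sum>u | u \<in> A \<and> u \<in> neighbors E w. f w)"
    by (rule sum.swap_restrict) auto
  also have "\<dots> = (\<Sum>w\<in>UNIV. card (neighbors E w \<inter> A) * f w)"
    by (intro sum.cong) (auto simp: Int_def conj_commute)
  finally show ?thesis .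
qed

section \<open>Estimates for the eigenvector scaled to maximum 1\<close>

text \<open>The bound on \<open>n\<close> is \<open>18 * k / \<alpha>^2\<close> with \<alpha>
  substituted, so its constant is \<open>18 * 24^2\<close>.\<close>

locale normalized_eigenvector =
  fixes k n :: nat and E :: "('v::finite) set set" and y :: "'v \<Rightarrow> real" and \<rho> :: real and u' :: 'v
  assumes k: "k \<ge> 3"
    and graph: "simple_graph UNIV E"
    and n: "n = card (UNIV :: 'v set)"
    and n_large: "real n \<ge> 10368 * real k ^ 3 * (real k + 1)\<^sup>2"
    and sparse: "sparse_graph k UNIV E"
    and y_nonneg: "0 \<le> y v" and y_le_1: "y v \<le> 1" and y_max: "y u' = 1"
    and eigen: "(\<Sum>w\<in>neighbors E v. y w) = \<rho> * y v"
    and \<rho>: "\<rho>\<^sup>2 \<ge> real k * (real n - real k)"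
begin

lemma card_neighbors_le: "card (neighbors E v) \<le> n"
  unfolding n by (rule card_mono) auto

text \<open>The eigenvalue equation for the square of the adjacency matrix, whose entries count
  common neighbours.\<close>

lemma square_eigen: "\<rho>\<^sup>2 * y v = (\<Sum>w\<in>UNIV. card (neighbors E w \<inter> neighbors E v) * y w)"
proof -
  have "\<rho>\<^sup>2 * y v = (\<Sum>u\<in>neighbors E v. \<rho> * y u)"
    by (simp add: power2_eq_square mult.assoc eigen[symmetric] sum_distrib_left)
  also have "\<dots> = (\<Sum>u\<in>neighbors E v. \<Sum>w\<in>neighbors E u. y w)" by (simp add: eigen)
  finally show ?thesis by (simp add: sum_neighbors_swap)
qed

text \<open>Sparsity bounds the sum of common-neighbour counts over any \<open>T\<close>, which is
  what \<open>weighted_sum_bound\<close> requires with \<open>K = k\<close> and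
  \<open>D = k * d(v)\<close>. The choice \<open>L = {}\<close>, \<open>\<beta> = 1\<close> gives
  the degree bound; taking \<open>L\<close> to be the large entries gives their number.\<close>

lemma square_eigen_bound:
  fixes \<beta> :: real
  assumes "\<And>w. w \<notin> L \<Longrightarrow> y w \<le> \<beta>" and "0 \<le> \<beta>" "\<beta> \<le> 1"
  shows "\<rho>\<^sup>2 * y v \<le> real k * sum y UNIV + \<beta> * (real k * real (card (neighbors E v)))
    + (1 - \<beta>) * (real (card L) * real (card (neighbors E v)))"
  unfolding square_eigen
proof (rule weighted_sum_bound)
  fix T :: "'v set"
  have "real (\<Sum>w\<in>T. card (neighbors E w \<inter> neighbors E v))
      \<le> real (k * (card (neighbors E v) + card T))"
    using sparse_graph_sum_neighbors[OF sparse graph, of "neighbors E v" T] of_nat_le_iff by blast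
  then show "(\<Sum>w\<in>T. real (card (neighbors E w \<inter> neighbors E v)))
      \<le> real k * real (card (neighbors E v)) + real k * real (card T)"
    by (simp add: distrib_left)
  show "real (card (neighbors E w \<inter> neighbors E v)) \<le> real (card (neighbors E v))" for w
    by (simp add: card_mono)
qed (use assms y_nonneg y_le_1 in auto)

text \<open>These absorb the error \<open>k * k\<close> coming from \<open>k * (n - k)\<close> in
  the two final estimates.\<close>

lemma n_bounds: "real n > 0" "real k * real k \<le> real n / 54" "real k * real k \<le> real n / (3 * real k)"
proof -
  have k': "real k \<ge> 3" using k by simp
  have "real k ^ 3 * 1 \<le> real k ^ 3 * (real k + 1)\<^sup>2"
    using k' by (intro mult_left_mono one_le_power) auto
  moreover have pos: "0 < real k ^ 3" using k' by simp
  ultimately have *: "162 * real k ^ 3 \<le> real n" using n_large by linarith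
  then show "real n > 0" using pos by linarith
  have "3 * real k ^ 2 \<le> real k ^ 3"
    using k' by (simp add: power3_eq_cube power2_eq_square)
  then show "real k * real k \<le> real n / 54" using * pos by (simp add: power2_eq_square)
  show "real k * real k \<le> real n / (3 * real k)"
    using * pos k' by (simp add: field_simps power3_eq_cube)
qed

text \<open>Summing the eigenvalue equation over all vertices gives \<open>\<rho> * ?s\<close> as a
  degree sum weighted by \<open>y\<close>, hence at most \<open>2 * k * n\<close>. With
  \<open>\<rho>^2 \<ge> k * n / 2\<close> this yields \<open>?s^2 \<le> 8 * k * n\<close>, and the
  size of \<open>n\<close> does the rest.\<close>

lemma sum_y_bound: "sum y UNIV \<le> real n / (36 * real k * (real k + 1))"
proof -
  have k': "real k \<ge> 3" using k by simp
  let ?s = "sum y UNIV"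
  have s0: "0 \<le> ?s" using y_nonneg by (simp add: sum_nonneg)
  have "\<rho> * ?s = (\<Sum>w\<in>UNIV. card (neighbors E w) * y w)"
    using sum_neighbors_swap[where E = E and f = y and A = UNIV] by (simp add: eigen sum_distrib_left)
  moreover have "0 \<le> (\<Sum>w\<in>UNIV. card (neighbors E w) * y w)"
    using y_nonneg by (simp add: sum_nonneg)
  moreover have "(\<Sum>w\<in>UNIV. card (neighbors E w) * y w) \<le> (\<Sum>w\<in>UNIV. real (card (neighbors E w)))"
    using y_le_1 by (intro sum_mono) (simp add: mult_left_le)
  moreover have "(\<Sum>w\<in>UNIV. real (card (neighbors E w))) \<le> 2 * real k * real n"
  proof -
    have "(\<Sum>w\<in>UNIV. card (neighbors E w)) \<le> k * (n + n)"
      using sparse_graph_sum_neighbors[OF sparse graph, of UNIV UNIV] n by simp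
    then have "real (\<Sum>w\<in>UNIV. card (neighbors E w)) \<le> real (k * (n + n))"
      by (simp only: of_nat_le_iff)
    then show ?thesis by simp
  qed
  ultimately have "0 \<le> \<rho> * ?s" "\<rho> * ?s \<le> 2 * real k * real n" by linarith+
  then have "(\<rho> * ?s)\<^sup>2 \<le> (2 * real k * real n)\<^sup>2" by (intro power_mono)
  then have 1: "\<rho>\<^sup>2 * ?s\<^sup>2 \<le> 4 * (real k)\<^sup>2 * (real n)\<^sup>2" by (simp add: power_mult_distrib)
  have "real k * 3 \<le> real k * real k" using k' by (intro mult_left_mono) auto
  then have "real n / 2 \<le> real n - real k" using n_bounds by linarith
  then have "real k * (real n / 2) \<le> \<rho>\<^sup>2"
    using \<rho> k' mult_left_mono[of "real n / 2" "real n - real k" "real k"] by linarith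
  then have "real k * (real n / 2) * ?s\<^sup>2 \<le> 4 * (real k)\<^sup>2 * (real n)\<^sup>2"
    using 1 mult_right_mono[of "real k * (real n / 2)" "\<rho>\<^sup>2" "?s\<^sup>2"] by simp
  then have "(real k * real n) * ?s\<^sup>2 \<le> (real k * real n) * (8 * real k * real n)"
    by (simp add: power2_eq_square algebra_simps)
  then have 2: "?s\<^sup>2 \<le> 8 * real k * real n"
    using k' n_bounds by (simp only: mult_le_cancel_left_pos mult_pos_pos)
  \<comment> \<open>The constant is also \<open>8 * 36^2\<close>, matching the bound
    \<open>8 * k * n\<close> and the denominator \<open>36 * k * (k + 1)\<close>.\<close>
  have "10368 * real k ^ 3 * (real k + 1)\<^sup>2 * real n \<le> real n * real n"
    using n_large n_bounds by (intro mult_right_mono) auto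
  then have "8 * real k * real n * (36 * real k * (real k + 1))\<^sup>2 \<le> (real n)\<^sup>2"
    by (simp add: power2_eq_square power3_eq_cube algebra_simps)
  moreover have "?s\<^sup>2 * (36 * real k * (real k + 1))\<^sup>2
      \<le> 8 * real k * real n * (36 * real k * (real k + 1))\<^sup>2"
    using 2 by (intro mult_right_mono) auto
  ultimately have "(?s * (36 * real k * (real k + 1)))\<^sup>2 \<le> (real n)\<^sup>2"
    unfolding power_mult_distrib[of ?s] by linarith
  then have "?s * (36 * real k * (real k + 1)) \<le> real n"
    by (rule power2_le_imp_le) simp
  then show ?thesis using k' by (simp add: pos_le_divide_eq)
qed

lemma k_sum_y_bound: "real k * sum y UNIV \<le> real n / (36 * real k)"
proof -
  have k': "real k \<ge> 3" using k by simp
  have "real k * sum y UNIV \<le> real k * (real n / (36 * real k * (real k + 1)))"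
    using sum_y_bound k' by (intro mult_left_mono) auto
  also have "\<dots> = real n / (36 * (real k + 1))" using k' by simp
  also have "\<dots> \<le> real n / (36 * real k)" using k' by (intro divide_left_mono) auto
  finally show ?thesis .
qed

text \<open>Replacing \<open>y v\<close> by \<open>1 - 1 / (2 * k)\<close> costs
  \<open>n / 2\<close> out of \<open>k * n\<close>. The remaining errors, at most
  \<open>n / 54 + n / 108\<close>, fit into the gap \<open>n / 6\<close> between
  \<open>n / 2\<close> and \<open>2 * n / 3\<close>.\<close>

lemma degree_bound:
  assumes "y v \<ge> 1 - 1 / (2 * real k)"
  shows "real (card (neighbors E v)) \<ge> (1 - 2 / (3 * real k)) * real n"
proof -
  have k': "real k \<ge> 3" using k by simp
  let ?d = "real (card (neighbors E v))"
  have "real k * 3 \<le> real k * real k" using k' by (intro mult_left_mono) auto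
  then have "real k \<le> real n" using n_bounds by linarith
  then have "(real k * (real n - real k)) * (1 - 1 / (2 * real k)) \<le> \<rho>\<^sup>2 * y v"
    using assms \<rho> k' by (intro mult_mono) auto
  also have "\<dots> \<le> k * sum y UNIV + k * ?d"
    using square_eigen_bound[of "{}" 1 v] y_le_1 by simp
  also have "(real k * (real n - real k)) * (1 - 1 / (2 * real k))
      = real k * real n - real k * real k - real n / 2 + real k / 2"
    using k' by (simp add: field_simps)
  finally have "real k * real n - real k * real k - real n / 2 + real k / 2
      \<le> k * sum y UNIV + k * ?d" .
  moreover have "real n / (36 * real k) \<le> real n / 108"
    using k' by (intro divide_left_mono) auto
  ultimately have "real k * real n - 2 / 3 * real n \<le> k * ?d"
    using k_sum_y_bound n_bounds(2) k' by linarith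
  then show ?thesis using k' by (simp add: field_simps)
qed

text \<open>With at most \<open>k - 1\<close> large entries, the coefficient of the degree at
  \<open>u'\<close> drops from \<open>k\<close> to \<open>k - 1 / (2 * k)\<close>. The loss
  \<open>n / (2 * k)\<close> exceeds the available errors
  \<open>n / (36 * k) + n / (3 * k)\<close>.\<close>

lemma card_large_entries: "card {v. y v \<ge> 1 - 1 / (2 * real k)} \<ge> k"
proof (rule ccontr)
  let ?L = "{v. y v \<ge> 1 - 1 / (2 * real k)}" and ?d = "real (card (neighbors E u'))"
  assume "\<not> ?thesis"
  then have L: "real (card ?L) \<le> real k - 1" by linarith
  have k': "real k \<ge> 3" using k by simp
  have "real k * (real n - real k) \<le> \<rho>\<^sup>2 * y u'" using \<rho> y_max by simp
  also have "\<dots> \<le> real k * sum y UNIV + (1 - 1 / (2 * real k)) * (real k * ?d)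
      + (1 - (1 - 1 / (2 * real k))) * (real (card ?L) * ?d)"
    using k' by (intro square_eigen_bound) auto
  also have "\<dots> \<le> real k * sum y UNIV + (1 - 1 / (2 * real k)) * (real k * ?d)
      + (1 - (1 - 1 / (2 * real k))) * ((real k - 1) * ?d)"
    using L k' by (intro add_left_mono mult_left_mono mult_right_mono) auto
  also have "\<dots> = real k * sum y UNIV + (real k - 1 / (2 * real k)) * ?d"
    using k' by (simp add: field_simps)
  also have "\<dots> \<le> real k * sum y UNIV + (real k - 1 / (2 * real k)) * real n"
  proof -
    have "1 / (2 * real k) \<le> 1" using k' by simp
    then have "0 \<le> real k - 1 / (2 * real k)" using k' by linarith
    then show ?thesis using card_neighbors_le[of u'] by (intro add_left_mono mult_left_mono) auto
  qed
  finally have "real k * real n - real k * real k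
      \<le> real n / (36 * real k) + (real k * real n - real n / (2 * real k))"
    using k_sum_y_bound by (simp add: algebra_simps)
  then have "real n / (2 * real k) \<le> real n / (36 * real k) + real n / (3 * real k)"
    using n_bounds(3) by linarith
  then show False using k' n_bounds(1) by (simp add: field_simps)
qed

end

section \<open>Return to the unscaled eigenvector\<close>

theorem theorem1p2:
  fixes k n :: nat
    and \<alpha> :: real
    and E :: "('v::finite) set set"
    and x :: "real ^ 'v"
    and u' :: 'v
  assumes "k \<ge> 3"
    and "\<alpha> = 1 / (24 * real k * (real k + 1))"
    and "simple_graph (UNIV :: 'v set) E"
    and "n = card (UNIV :: 'v set)"
    and "real n \<ge> 18 * real k / \<alpha>\<^sup>2"
    and "minimally_k_connected k UNIV E \<or> minimally_k_edge_connected k UNIV E"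
    and "eigenvector (adjacency_matrix E) x (graph_spectral_radius E)"
    and "\<forall>v. x $ v \<ge> 0"
    and "x $ u' = Max (range (\<lambda>v. x $ v))"
    and "(graph_spectral_radius E)\<^sup>2 \<ge> real k * (real n - real k)"
  shows "\<exists>L :: 'v set. card L = k \<and>
           (\<forall>v\<in>L. x $ v \<ge> (1 - 1 / (2 * real k)) * x $ u' \<and>
                  real (vdegree E v) \<ge> (1 - 2 / (3 * real k)) * real n)"
proof -
  have le: "x $ v \<le> x $ u'" for v unfolding assms(9) by (rule Max_ge) auto
  obtain v where "x $ v \<noteq> 0" using assms(7) by (auto simp: eigenvector_def vec_eq_iff)
  then have "x $ v > 0" using assms(8) by (simp add: order_less_le)
  \<comment> \<open>A positive maximum is what permits scaling the eigenvector to maximum 1.\<close>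
  then have pos: "x $ u' > 0" using le[of v] by linarith
  have "18 * real k / \<alpha>\<^sup>2 = 10368 * real k ^ 3 * (real k + 1)\<^sup>2"
    unfolding assms(2) by (simp add: power_divide power_mult_distrib power2_eq_square power3_eq_cube)
  moreover have "sparse_graph k UNIV E"
    using assms(6)
  proof
    assume "minimally_k_connected k UNIV E"
    then show ?thesis using assms(1,3) by (intro minimally_k_connected_sparse) auto
  next
    assume "minimally_k_edge_connected k UNIV E"
    then show ?thesis using assms(3) by (rule minimally_k_edge_connected_sparse)
  qed
  moreover have "(\<Sum>w\<in>neighbors E v. x $ w / x $ u') = graph_spectral_radius E * (x $ v / x $ u')" for v
    using eigenvector_sum_neighbors[OF assms(7), of v] by (simp add: sum_divide_distrib[symmetric])
  ultimately interpret normalized_eigenvector k n E "\<lambda>v. x $ v / x $ u'" "graph_spectral_radius E" u'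
    using assms le pos by unfold_locales auto
  \<comment> \<open>Any \<open>k\<close> of the large entries will do, since
    \<open>degree_bound\<close> applies to each of them.\<close>
  obtain L where L: "L \<subseteq> {v. x $ v / x $ u' \<ge> 1 - 1 / (2 * real k)}" "card L = k"
    using card_large_entries obtain_subset_with_card_n by metis
  have "x $ v \<ge> (1 - 1 / (2 * real k)) * x $ u' \<and>
      real (vdegree E v) \<ge> (1 - 2 / (3 * real k)) * real n" if "v \<in> L" for v
  proof -
    have v: "x $ v / x $ u' \<ge> 1 - 1 / (2 * real k)" using that L by auto
    then show ?thesis
      using degree_bound[OF v] pos
      by (simp add: vdegree_eq_card_neighbors[OF assms(3)] pos_le_divide_eq)
  qed
  with L(2) show ?thesis by blast
qed

end
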